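(* Let (CQ), (MQ), (MC), (MCQ) denote the four statements (representing respectively the CQ method, the monotone Q method, the monotone C method and the monotone CQ method) formulated in the context. Then $$\text{(CQ) true}\ \Rightarrow\ \text{(MQ) true}\ \Rightarrow\ \text{(MC) true}\ \Leftrightarrow\ \text{(MCQ) true}.$$
   Context: $F(T)=\{x\in C:Tx=x\}$; $T:C\to C$ is nonexpansive if $\|Tx-Ty\|\le\|x-y\|$ for all $x,y\in C$. For a nonempty closed convex set $D$ in a Hilbert space, $P_D$ is the metric projection (nearest-point map) onto $D$. In each of the four statements, the following data are universally quantified: a nonempty closed convex subset $C$ of a real Hilbert space $H$; a nonexpansive $T:C\to C$ with $F(T)\ne\emptyset$; a point $x_0\in C$; a real sequence $\{\alpha_n\}_{n\ge0}$ with $0<\alpha\le\alpha_n\le1$ for all $n$, for some constant $\alpha$. Always $y_n=(1-\alpha_n)x_n+\alpha_nTx_n$ for $n\ge 0$. (CQ): If for all $n\ge0$, $C_n=\{z\in C:\|y_n-z\|\le\|x_n-z\|\}$, $Q_n=\{z\in C:\langle z-x_n,x_n-x_0\rangle\ge0\}$, $x_{n+1}=P_{D_n\cap Q_n}x_0$, where $D_n$ is any closed convex set with $F(T)\subset D_n\subset C_n$, then $\{x_n\}$ converges strongly to $P_{F(T)}x_0$. (MQ): If for all $n\ge0$, $C_n=\{z\in C:\|y_n-z\|\le\|x_n-z\|\}$; $Q_0=C$ and $Q_n=\{z\in Q_{n-1}:\langle z-x_n,x_n-x_0\rangle\ge0\}$ for $n\ge1$; $x_{n+1}=P_{D_n\cap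 Q_n}x_0$, where $D_n$ is any closed convex set with $F(T)\subset D_n\subset C_n$, then $\{x_n\}$ converges strongly to $P_{F(T)}x_0$. (MC): If $D_0=C_0=C$ and for all $n\ge0$, $C_{n+1}=\{z\in D_n:\|y_n-z\|\le\|x_n-z\|\}$, $x_{n+1}=P_{D_{n+1}}x_0$, where $D_{n+1}$ is any closed convex set with $F(T)\subset D_{n+1}\subset C_{n+1}$, then $\{x_n\}$ converges strongly to $P_{F(T)}x_0$. (MCQ): If $C_0=\{z\in C:\|y_0-z\|\le\|x_0-z\|\}$, $Q_0=C$, and for $n\ge1$, $C_n=\{z\in D_{n-1}\cap Q_{n-1}:\|y_n-z\|\le\|x_n-z\|\}$, $Q_n=\{z\in D_{n-1}\cap Q_{n-1}:\langle z-x_n,x_n-x_0\rangle\ge0\}$, and for all $n\ge0$, $x_{n+1}=P_{D_n\cap Q_n}x_0$, where $D_n$ is any closed convex set with $F(T)\subset D_n\subset C_n$, then $\{x_n\}$ converges strongly to $P_{F(T)}x_0$. *)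

theory Defs
  imports "HOL-Analysis.Analysis"
begin

text \<open>
  Real Hilbert spaces are types of sort \<open>{real_inner, complete_space}\<close>.
\<close>

text \<open>
  The library's \<open>closest_point\<close> requires the Heine--Borel property, i.e. finite dimension.
  The description is meaningful when \<open>S\<close> is nonempty, closed and convex; see
  \<open>ex1_nearest_point\<close> below.
\<close>

definition metric_proj :: "'a::{real_inner, complete_space} set \<Rightarrow> 'a \<Rightarrow> 'a" where
  "metric_proj S x = (THE p. p \<in> S \<and> (\<forall>q\<in>S. norm (x - p) \<le> norm (x - q)))"

definition fixed_points :: "'a set \<Rightarrow> ('a \<Rightarrow> 'a) \<Rightarrow> 'a set" where
  "fixed_points C T = {x \<in> C. T x = x}"

definition nonexpansive_on :: "'a::real_normed_vector set \<Rightarrow> ('a \<Rightarrow> 'a) \<Rightarrow> bool" where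
  "nonexpansive_on C T \<longleftrightarrow> (\<forall>x\<in>C. \<forall>y\<in>C. norm (T x - T y) \<le> norm (x - y))"

definition iteration_data ::
    "'a::{real_inner, complete_space} set \<Rightarrow> ('a \<Rightarrow> 'a) \<Rightarrow> 'a \<Rightarrow> (nat \<Rightarrow> real)
      \<Rightarrow> (nat \<Rightarrow> 'a) \<Rightarrow> (nat \<Rightarrow> 'a) \<Rightarrow> bool" where
  "iteration_data C T x0 \<alpha> x y \<longleftrightarrow>
     C \<noteq> {} \<and> closed C \<and> convex C \<and>
     T ` C \<subseteq> C \<and> nonexpansive_on C T \<and> fixed_points C T \<noteq> {} \<and>
     x0 \<in> C \<and> (\<exists>a>0. \<forall>n. a \<le> \<alpha> n \<and> \<alpha> n \<le> 1) \<and>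
     x 0 = x0 \<and> (\<forall>n. y n = (1 - \<alpha> n) *\<^sub>R x n + \<alpha> n *\<^sub>R T (x n))"

text \<open>
  The four convergence statements. The bound variables \<open>Cs\<close>, \<open>Qs\<close>, \<open>D\<close> stand for
  the set sequences of the methods. The choice of ``any'' closed convex set \<open>D n\<close> at each step becomes universal quantification
  over all sequences \<open>D\<close> that satisfy, together with \<open>x\<close>, the recursion.
\<close>

definition CQ_statement :: "'a::{real_inner, complete_space} itself \<Rightarrow> bool" where
  "CQ_statement _ \<longleftrightarrow>
    (\<forall>(C :: 'a set) T x0 \<alpha> x y Cs Qs D.
       iteration_data C T x0 \<alpha> x y \<longrightarrow>
       (\<forall>n. Cs n = {z \<in> C. norm (y n - z) \<le> norm (x n - z)}) \<longrightarrow>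
       (\<forall>n. Qs n = {z \<in> C. (z - x n) \<bullet> (x n - x0) \<ge> 0}) \<longrightarrow>
       (\<forall>n. closed (D n) \<and> convex (D n) \<and> fixed_points C T \<subseteq> D n \<and> D n \<subseteq> Cs n) \<longrightarrow>
       (\<forall>n. x (Suc n) = metric_proj (D n \<inter> Qs n) x0) \<longrightarrow>
       x \<longlonglongrightarrow> metric_proj (fixed_points C T) x0)"

definition MQ_statement :: "'a::{real_inner, complete_space} itself \<Rightarrow> bool" where
  "MQ_statement _ \<longleftrightarrow>
    (\<forall>(C :: 'a set) T x0 \<alpha> x y Cs Qs D.
       iteration_data C T x0 \<alpha> x y \<longrightarrow>
       (\<forall>n. Cs n = {z \<in> C. norm (y n - z) \<le> norm (x n - z)}) \<longrightarrow>
       Qs 0 = C \<longrightarrow>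
       (\<forall>n. Qs (Suc n) = {z \<in> Qs n. (z - x (Suc n)) \<bullet> (x (Suc n) - x0) \<ge> 0}) \<longrightarrow>
       (\<forall>n. closed (D n) \<and> convex (D n) \<and> fixed_points C T \<subseteq> D n \<and> D n \<subseteq> Cs n) \<longrightarrow>
       (\<forall>n. x (Suc n) = metric_proj (D n \<inter> Qs n) x0) \<longrightarrow>
       x \<longlonglongrightarrow> metric_proj (fixed_points C T) x0)"

definition MC_statement :: "'a::{real_inner, complete_space} itself \<Rightarrow> bool" where
  "MC_statement _ \<longleftrightarrow>
    (\<forall>(C :: 'a set) T x0 \<alpha> x y Cs D.
       iteration_data C T x0 \<alpha> x y \<longrightarrow>
       D 0 = C \<longrightarrow> Cs 0 = C \<longrightarrow>
       (\<forall>n. Cs (Suc n) = {z \<in> D n. norm (y n - z) \<le> norm (x n - z)}) \<longrightarrow>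
       (\<forall>n. closed (D (Suc n)) \<and> convex (D (Suc n)) \<and>
            fixed_points C T \<subseteq> D (Suc n) \<and> D (Suc n) \<subseteq> Cs (Suc n)) \<longrightarrow>
       (\<forall>n. x (Suc n) = metric_proj (D (Suc n)) x0) \<longrightarrow>
       x \<longlonglongrightarrow> metric_proj (fixed_points C T) x0)"

definition MCQ_statement :: "'a::{real_inner, complete_space} itself \<Rightarrow> bool" where
  "MCQ_statement _ \<longleftrightarrow>
    (\<forall>(C :: 'a set) T x0 \<alpha> x y Cs Qs D.
       iteration_data C T x0 \<alpha> x y \<longrightarrow>
       Cs 0 = {z \<in> C. norm (y 0 - z) \<le> norm (x 0 - z)} \<longrightarrow>
       Qs 0 = C \<longrightarrow>
       (\<forall>n. Cs (Suc n) =
          {z \<in> D n \<inter> Qs n. norm (y (Suc n) - z) \<le> norm (x (Suc n) - z)}) \<longrightarrow>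
       (\<forall>n. Qs (Suc n) =
          {z \<in> D n \<inter> Qs n. (z - x (Suc n)) \<bullet> (x (Suc n) - x0) \<ge> 0}) \<longrightarrow>
       (\<forall>n. closed (D n) \<and> convex (D n) \<and> fixed_points C T \<subseteq> D n \<and> D n \<subseteq> Cs n) \<longrightarrow>
       (\<forall>n. x (Suc n) = metric_proj (D n \<inter> Qs n) x0) \<longrightarrow>
       x \<longlonglongrightarrow> metric_proj (fixed_points C T) x0)"

lemma parallelogram_midpoint:
  fixes x p q :: "'a::real_inner"
  shows "(norm (p - q))\<^sup>2 =
    2 * (norm (x - p))\<^sup>2 + 2 * (norm (x - q))\<^sup>2 - 4 * (norm (x - midpoint p q))\<^sup>2"
proof -
  have "4 * (norm (x - midpoint p q))\<^sup>2 = (norm ((x - p) + (x - q)))\<^sup>2"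
  proof -
    have "(x - p) + (x - q) = 2 *\<^sub>R (x - midpoint p q)"
      by (simp add: midpoint_def algebra_simps scaleR_2)
    then show ?thesis
      by (simp only: norm_scaleR) (simp add: power_mult_distrib)
  qed
  moreover have "(norm (p - q))\<^sup>2 = (norm ((x - p) - (x - q)))\<^sup>2"
    by (simp add: norm_minus_commute)
  ultimately show ?thesis
    by (simp add: power2_norm_eq_inner inner_add_left inner_add_right inner_diff_left
        inner_diff_right inner_commute)
qed

lemma ex1_nearest_point:
  fixes S :: "'a::{real_inner, complete_space} set"
  assumes "S \<noteq> {}" "closed S" "convex S"
  shows "\<exists>!p. p \<in> S \<and> (\<forall>q\<in>S. norm (x - p) \<le> norm (x - q))"
proof -
  define d where "d = infdist x S"
  define t where "t n = 1 / (real n + 1)" for n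
  define A where "A n = S \<inter> cball x (d + t n)" for n
  have t: "0 < t n" "t n \<le> 1" for n by (auto simp: t_def)
  have d0: "0 \<le> d" by (simp add: d_def infdist_nonneg)
  have dle: "d \<le> norm (x - q)" if "q \<in> S" for q
    using infdist_le[OF that, of x] by (simp add: d_def dist_norm)
  have gap: "(norm (p - q))\<^sup>2 \<le> 2 * (norm (x - p))\<^sup>2 + 2 * (norm (x - q))\<^sup>2 - 4 * d\<^sup>2"
    if "p \<in> S" "q \<in> S" for p q
  proof -
    have "midpoint p q \<in> S"
      using that \<open>convex S\<close> by (meson convex_contains_segment midpoint_in_closed_segment subsetD)
    then have "d\<^sup>2 \<le> (norm (x - midpoint p q))\<^sup>2"
      using dle d0 by (intro power_mono) auto
    then show ?thesis
      using parallelogram_midpoint[of p q x] by simp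
  qed
  obtain p where p: "\<And>n. p \<in> A n"
  proof (rule decreasing_closed_nest)
    show "closed (A n)" for n using \<open>closed S\<close> by (auto simp: A_def)
    show "A n \<noteq> {}" for n
    proof -
      have "infdist x S < d + t n" using t by (simp add: d_def)
      then obtain p where "p \<in> S" "dist x p < d + t n"
        using \<open>S \<noteq> {}\<close> by (auto simp: infdist_notempty cINF_less_iff)
      then show ?thesis by (auto simp: A_def)
    qed
    show "A n \<subseteq> A m" if "m \<le> n" for m n
    proof -
      have "t n \<le> t m" using that by (simp add: t_def frac_le)
      then show ?thesis by (auto simp: A_def)
    qed
    show "\<exists>n. \<forall>p\<in>A n. \<forall>q\<in>A n. dist p q < e" if "e > 0" for e
    proof -
      obtain n where n: "(8 * d + 4) / e\<^sup>2 < real n" using reals_Archimedean2 by blast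
      have "(8 * d + 4) * t n < e\<^sup>2"
        using n that d0 by (simp add: t_def field_simps) (simp add: add_strict_increasing)
      moreover have "(dist p q)\<^sup>2 \<le> (8 * d + 4) * t n" if "p \<in> A n" "q \<in> A n" for p q
      proof -
        have "(norm (x - p))\<^sup>2 \<le> (d + t n)\<^sup>2" "(norm (x - q))\<^sup>2 \<le> (d + t n)\<^sup>2"
          using that by (auto simp: A_def dist_norm intro!: power_mono)
        then have "(norm (p - q))\<^sup>2 \<le> 8 * d * t n + 4 * (t n)\<^sup>2"
          using gap[of p q] that by (simp add: A_def power2_sum)
        moreover have "(t n)\<^sup>2 \<le> t n"
          using t[of n] by (simp add: power2_eq_square mult_left_le)
        ultimately show ?thesis by (simp add: dist_norm algebra_simps)
      qed
      ultimately have "\<forall>p\<in>A n. \<forall>q\<in>A n. dist p q < e"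
        using that by (meson le_less_trans less_imp_le power_less_imp_less_base)
      then show ?thesis ..
    qed
  qed blast
  have "norm (x - p) \<le> d"
  proof (rule field_le_epsilon)
    fix e :: real assume "e > 0"
    then obtain n where "1 / (real n + 1) < e"
      using nat_approx_posE by (metis of_nat_Suc add.commute)
    then show "norm (x - p) \<le> d + e"
      using p[of n] by (simp add: A_def t_def dist_norm)
  qed
  then have p': "p \<in> S" "\<forall>q\<in>S. norm (x - p) \<le> norm (x - q)" "norm (x - p) = d"
    using p[of 0] dle by (auto simp: A_def intro: order_trans order_antisym)
  moreover have "p = q" if "q \<in> S" "\<forall>r\<in>S. norm (x - q) \<le> norm (x - r)" for q
  proof -
    have "norm (x - q) = d" using that p' dle[of q] by (metis order_antisym)
    then show ?thesis using gap[of p q] p' that by simp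
  qed
  ultimately show ?thesis by blast
qed

end

theory Submission
  imports Defs
begin

text \<open>
  Each implication is a reduction: a run \<open>x\<close> of the method in the conclusion is, with the same
  \<open>x\<close>, also a run of the method in the hypothesis, once that method's free closed convex sets
  are chosen suitably. The convergence claim is then inherited unchanged.

  Two facts make the reductions work. The first is the variational inequality for a projection
  \<open>p\<close> of \<open>x0\<close> onto a closed convex set \<open>S\<close>: every \<open>z \<in> S\<close> satisfies
  \<open>(z - p) \<bullet> (p - x0) \<ge> 0\<close>, so that \<open>S\<close> lies in the half-space by which the next \<open>Q\<close>-set
  is cut (\<open>metric_proj_variational\<close>). The second, which follows by induction from the first,
  is that the \<open>Q\<close>-sets of the methods with monotone \<open>Q\<close> are closed, convex and contain all
  fixed points (\<open>cut_sets_admissible\<close>).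

  If the target method has sets \<open>D n\<close> and \<open>Q n\<close>, the second fact allows \<open>D n \<inter> Q n\<close> itself
  to serve as the freely chosen set of the other method; this gives the passage from (CQ) to
  (MQ), where the non-monotone \<open>Q\<close>-set contains the monotone one, and from (MC) to (MCQ), where
  no \<open>Q\<close>-set is left. In the opposite direction, when the target is (MC), its sets decrease,
  and the first fact shows that intersecting them with the \<open>Q\<close>-sets of (MQ) or of (MCQ)
  removes nothing (\<open>decreasing_subset_cut_sets\<close>).
\<close>

section \<open>Projections and half-spaces\<close>

lemma metric_proj_variational:
  fixes S :: "'a::{real_inner, complete_space} set"
  assumes "closed S" "convex S" "z \<in> S"
  shows "(z - metric_proj S a) \<bullet> (metric_proj S a - a) \<ge> 0"
proof -
  define p where "p = metric_proj S a"
  have "\<exists>!p. p \<in> S \<and> (\<forall>q\<in>S. norm (a - p) \<le> norm (a - q))"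
    using assms by (intro ex1_nearest_point) auto
  from theI'[OF this] have p: "p \<in> S" "\<forall>q\<in>S. dist a p \<le> dist a q"
    unfolding p_def metric_proj_def dist_norm by blast+
  have "(a - p) \<bullet> (z - p) \<le> 0"
    using any_closest_point_dot[OF assms(2,1) p(1) assms(3) p(2)] .
  then show ?thesis
    unfolding p_def [symmetric] by (simp add: inner_commute inner_diff_left inner_diff_right)
qed

lemma half_space_cut:
  fixes p :: "'a::real_inner"
  shows "{z \<in> A. (z - p) \<bullet> (p - a) \<ge> 0} = A \<inter> {z. (p - a) \<bullet> z \<ge> (p - a) \<bullet> p}"
  by (auto simp: inner_commute inner_diff_left inner_diff_right)

lemma closed_half_space_cut:
  fixes p :: "'a::real_inner"
  shows "closed A \<Longrightarrow> closed {z \<in> A. (z - p) \<bullet> (p - a) \<ge> 0}"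
  unfolding half_space_cut by (intro closed_Int closed_halfspace_ge)

lemma convex_half_space_cut:
  fixes p :: "'a::real_inner"
  shows "convex A \<Longrightarrow> convex {z \<in> A. (z - p) \<bullet> (p - a) \<ge> 0}"
  unfolding half_space_cut by (intro convex_Int convex_halfspace_ge)

section \<open>Monotone sequences of half-space cuts\<close>

text \<open>
  The update of \<open>Q\<close> cuts \<open>Q n\<close> in (MQ), but \<open>D n \<inter> Q n\<close> in (MCQ). The parameter \<open>B\<close>
  covers both. The induction needs all three properties at once: closedness and convexity of
  \<open>D n \<inter> Q n\<close> give the variational inequality for its projection, and this inequality is what
  keeps \<open>F\<close> in the next cut.
\<close>

lemma cut_sets_admissible:
  fixes D Q B :: "nat \<Rightarrow> 'a::{real_inner, complete_space} set"
  assumes Q0: "closed (Q 0)" "convex (Q 0)" "F \<subseteq> Q 0"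
    and D: "\<And>n. closed (D n) \<and> convex (D n) \<and> F \<subseteq> D n"
    and x: "\<And>n. x (Suc n) = metric_proj (D n \<inter> Q n) a"
    and B: "\<And>n. B n = Q n \<or> B n = D n \<inter> Q n"
    and Q: "\<And>n. Q (Suc n) = {z \<in> B n. (z - x (Suc n)) \<bullet> (x (Suc n) - a) \<ge> 0}"
  shows "closed (Q n) \<and> convex (Q n) \<and> F \<subseteq> Q n"
proof (induction n)
  case 0
  show ?case using Q0 by blast
next
  case (Suc n)
  have DQ: "closed (D n \<inter> Q n)" "convex (D n \<inter> Q n)" "F \<subseteq> D n \<inter> Q n"
    using D[of n] Suc by (auto intro: convex_Int)
  have B': "closed (B n)" "convex (B n)" "F \<subseteq> B n"
    using B[of n] Suc DQ by auto
  have "\<forall>z\<in>F. (z - x (Suc n)) \<bullet> (x (Suc n) - a) \<ge> 0"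
    using metric_proj_variational[OF DQ(1,2)] DQ(3) unfolding x by blast
  then show ?case
    unfolding Q using B' by (auto intro: closed_half_space_cut convex_half_space_cut)
qed

text \<open>
  The projection that defines the half-space cutting \<open>Q (Suc n)\<close> is onto \<open>D n\<close>, so that
  half-space contains \<open>D n\<close> and, by monotonicity, \<open>D (Suc n)\<close>.
\<close>

lemma decreasing_subset_cut_sets:
  fixes D Q B :: "nat \<Rightarrow> 'a::{real_inner, complete_space} set"
  assumes D0: "D 0 \<subseteq> Q 0"
    and D: "\<And>n. closed (D n) \<and> convex (D n) \<and> D (Suc n) \<subseteq> D n"
    and x: "\<And>n. x (Suc n) = metric_proj (D n) a"
    and B: "\<And>n. B n = Q n \<or> B n = D n \<inter> Q n"
    and Q: "\<And>n. Q (Suc n) = {z \<in> B n. (z - x (Suc n)) \<bullet> (x (Suc n) - a) \<ge> 0}"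
  shows "D n \<subseteq> Q n"
proof (induction n)
  case 0
  show ?case by (rule D0)
next
  case (Suc n)
  have "\<forall>z\<in>D n. (z - x (Suc n)) \<bullet> (x (Suc n) - a) \<ge> 0"
    using metric_proj_variational D[of n] unfolding x by blast
  moreover have "D (Suc n) \<subseteq> B n"
    using B[of n] Suc D[of n] by auto
  ultimately show ?case
    unfolding Q using D[of n] by auto
qed

section \<open>The four reductions\<close>

lemma iteration_dataD:
  assumes "iteration_data C T x0 \<alpha> x y"
  shows "closed C" "convex C" "fixed_points C T \<subseteq> C" "x 0 = x0"
  using assms by (auto simp: iteration_data_def fixed_points_def)

text \<open>
  The choice \<open>D n \<inter> Q n\<close> for the free set of (CQ) works because the half-space of (CQ)
  contains the monotone \<open>Q n\<close>; at \<open>n = 0\<close> it is the whole space, as \<open>x 0 = x0\<close>.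
\<close>

lemma CQ_imp_MQ:
  assumes CQ: "CQ_statement TYPE('a::{real_inner, complete_space})"
  shows "MQ_statement TYPE('a)"
  unfolding MQ_statement_def
proof (intro allI impI)
  fix C :: "'a set" and T x0 \<alpha> x y Cs Qs D
  assume data: "iteration_data C T x0 \<alpha> x y"
    and Cs: "\<forall>n. Cs n = {z \<in> C. norm (y n - z) \<le> norm (x n - z)}"
    and Q0: "Qs 0 = C"
    and Q: "\<forall>n. Qs (Suc n) = {z \<in> Qs n. (z - x (Suc n)) \<bullet> (x (Suc n) - x0) \<ge> 0}"
    and D: "\<forall>n. closed (D n) \<and> convex (D n) \<and> fixed_points C T \<subseteq> D n \<and> D n \<subseteq> Cs n"
    and x: "\<forall>n. x (Suc n) = metric_proj (D n \<inter> Qs n) x0"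
  note C = iteration_dataD[OF data]
  have adm: "closed (Qs n) \<and> convex (Qs n) \<and> fixed_points C T \<subseteq> Qs n" for n
    by (rule cut_sets_admissible[where Q = Qs and D = D and B = Qs and x = x and a = x0])
      (use C Q0 Q D x in auto)
  define Q' where "Q' n = {z \<in> C. (z - x n) \<bullet> (x n - x0) \<ge> 0}" for n
  have QC: "Qs n \<subseteq> C" for n
    by (induction n) (use Q0 Q in auto)
  have QQ': "Qs n \<subseteq> Q' n" for n
  proof (cases n)
    case 0
    then show ?thesis using Q0 C by (simp add: Q'_def)
  next
    case (Suc m)
    then show ?thesis using Q QC[of m] by (auto simp: Q'_def)
  qed
  have eq: "D n \<inter> Qs n \<inter> Q' n = D n \<inter> Qs n" for n
    using QQ' by blast
  show "x \<longlonglongrightarrow> metric_proj (fixed_points C T) x0"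
  proof (rule CQ[unfolded CQ_statement_def, rule_format, OF data])
    show "Cs n = {z \<in> C. norm (y n - z) \<le> norm (x n - z)}" for n
      using Cs by blast
    show "Q' n = {z \<in> C. (z - x n) \<bullet> (x n - x0) \<ge> 0}" for n
      by (rule Q'_def)
    show "closed (D n \<inter> Qs n) \<and> convex (D n \<inter> Qs n) \<and>
        fixed_points C T \<subseteq> D n \<inter> Qs n \<and> D n \<inter> Qs n \<subseteq> Cs n" for n
      using D[rule_format, of n] adm[of n] by (auto intro: convex_Int)
    show "x (Suc n) = metric_proj (D n \<inter> Qs n \<inter> Q' n) x0" for n
      using x eq by simp
  qed
qed

text \<open>
  (MC) projects onto \<open>D (n + 1)\<close> where (MQ) projects onto \<open>D n \<inter> Q n\<close>, hence the index
  shift. The \<open>Q\<close>-sets, absent from (MC), are generated from the given run by their own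
  recursion; since they contain the shifted \<open>D\<close>-sets, the projections agree.
\<close>

lemma MQ_imp_MC:
  assumes MQ: "MQ_statement TYPE('a::{real_inner, complete_space})"
  shows "MC_statement TYPE('a)"
  unfolding MC_statement_def
proof (intro allI impI)
  fix C :: "'a set" and T x0 \<alpha> x y Cs D
  assume data: "iteration_data C T x0 \<alpha> x y"
    and D0: "D 0 = C" and "Cs 0 = C"
    and Cs: "\<forall>n. Cs (Suc n) = {z \<in> D n. norm (y n - z) \<le> norm (x n - z)}"
    and D: "\<forall>n. closed (D (Suc n)) \<and> convex (D (Suc n)) \<and>
            fixed_points C T \<subseteq> D (Suc n) \<and> D (Suc n) \<subseteq> Cs (Suc n)"
    and x: "\<forall>n. x (Suc n) = metric_proj (D (Suc n)) x0"
  have dec: "D (Suc n) \<subseteq> D n" for n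
    using D[rule_format, of n] Cs by auto
  have DC: "D n \<subseteq> C" for n
    by (induction n) (use D0 dec in auto)
  define Q where
    "Q = rec_nat C (\<lambda>n A. {z \<in> A. (z - x (Suc n)) \<bullet> (x (Suc n) - x0) \<ge> 0})"
  have Q: "Q 0 = C"
    "Q (Suc n) = {z \<in> Q n. (z - x (Suc n)) \<bullet> (x (Suc n) - x0) \<ge> 0}" for n
    by (simp_all add: Q_def)
  have "D (Suc n) \<subseteq> Q n" for n
    by (rule decreasing_subset_cut_sets
          [where D = "\<lambda>n. D (Suc n)" and Q = Q and B = Q and x = x and a = x0])
      (use DC Q D x dec in auto)
  then have eq: "D (Suc n) \<inter> Q n = D (Suc n)" for n by blast
  show "x \<longlonglongrightarrow> metric_proj (fixed_points C T) x0"
  proof (rule MQ[unfolded MQ_statement_def, rule_format, OF data])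
    show "{z \<in> C. norm (y n - z) \<le> norm (x n - z)} = {z \<in> C. norm (y n - z) \<le> norm (x n - z)}"
      for n ..
    show "Q 0 = C" by (rule Q)
    show "Q (Suc n) = {z \<in> Q n. (z - x (Suc n)) \<bullet> (x (Suc n) - x0) \<ge> 0}" for n
      by (rule Q)
    show "closed (D (Suc n)) \<and> convex (D (Suc n)) \<and> fixed_points C T \<subseteq> D (Suc n) \<and>
        D (Suc n) \<subseteq> {z \<in> C. norm (y n - z) \<le> norm (x n - z)}" for n
      using D[rule_format, of n] Cs DC[of n] by auto
    show "x (Suc n) = metric_proj (D (Suc n) \<inter> Q n) x0" for n
      using x eq by simp
  qed
qed

text \<open>
  The free set of (MC) at step \<open>n + 1\<close> is \<open>D n \<inter> Q n\<close>. It satisfies the inclusion required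
  by (MC) because the \<open>C\<close>-sets of (MCQ) are cut from exactly these intersections.
\<close>

lemma MC_imp_MCQ:
  assumes MC: "MC_statement TYPE('a::{real_inner, complete_space})"
  shows "MCQ_statement TYPE('a)"
  unfolding MCQ_statement_def
proof (intro allI impI)
  fix C :: "'a set" and T x0 \<alpha> x y Cs Qs D
  assume data: "iteration_data C T x0 \<alpha> x y"
    and C0: "Cs 0 = {z \<in> C. norm (y 0 - z) \<le> norm (x 0 - z)}"
    and Q0: "Qs 0 = C"
    and Cs: "\<forall>n. Cs (Suc n) =
          {z \<in> D n \<inter> Qs n. norm (y (Suc n) - z) \<le> norm (x (Suc n) - z)}"
    and Q: "\<forall>n. Qs (Suc n) =
          {z \<in> D n \<inter> Qs n. (z - x (Suc n)) \<bullet> (x (Suc n) - x0) \<ge> 0}"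
    and D: "\<forall>n. closed (D n) \<and> convex (D n) \<and> fixed_points C T \<subseteq> D n \<and> D n \<subseteq> Cs n"
    and x: "\<forall>n. x (Suc n) = metric_proj (D n \<inter> Qs n) x0"
  note C = iteration_dataD[OF data]
  have adm: "closed (Qs n) \<and> convex (Qs n) \<and> fixed_points C T \<subseteq> Qs n" for n
    by (rule cut_sets_admissible
          [where Q = Qs and D = D and B = "\<lambda>n. D n \<inter> Qs n" and x = x and a = x0])
      (use C Q0 Q D x in auto)
  define D' where "D' n = (case n of 0 \<Rightarrow> C | Suc m \<Rightarrow> D m \<inter> Qs m)" for n
  define C' where
    "C' n = (case n of 0 \<Rightarrow> C | Suc m \<Rightarrow> {z \<in> D' m. norm (y m - z) \<le> norm (x m - z)})" for n
  have sub: "D n \<subseteq> C' (Suc n)" for n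
    using D[rule_format, of n] C0 Cs by (cases n) (auto simp: C'_def D'_def)
  show "x \<longlonglongrightarrow> metric_proj (fixed_points C T) x0"
  proof (rule MC[unfolded MC_statement_def, rule_format, OF data])
    show "D' 0 = C" "C' 0 = C" by (simp_all add: D'_def C'_def)
    show "C' (Suc n) = {z \<in> D' n. norm (y n - z) \<le> norm (x n - z)}" for n
      by (simp add: C'_def)
    show "closed (D' (Suc n)) \<and> convex (D' (Suc n)) \<and>
        fixed_points C T \<subseteq> D' (Suc n) \<and> D' (Suc n) \<subseteq> C' (Suc n)" for n
      using D[rule_format, of n] adm[of n] sub[of n] by (auto simp: D'_def intro: convex_Int)
    show "x (Suc n) = metric_proj (D' (Suc n)) x0" for n
      using x by (simp add: D'_def)
  qed
qed

text \<open>
  As in the passage from (MQ), with the shifted \<open>C\<close>-sets of (MC) now serving as \<open>C\<close>-sets of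
  (MCQ): the latter are cut from \<open>D n \<inter> Q n\<close>, which is just the shifted \<open>D n\<close>.
\<close>

lemma MCQ_imp_MC:
  assumes MCQ: "MCQ_statement TYPE('a::{real_inner, complete_space})"
  shows "MC_statement TYPE('a)"
  unfolding MC_statement_def
proof (intro allI impI)
  fix C :: "'a set" and T x0 \<alpha> x y Cs D
  assume data: "iteration_data C T x0 \<alpha> x y"
    and D0: "D 0 = C" and "Cs 0 = C"
    and Cs: "\<forall>n. Cs (Suc n) = {z \<in> D n. norm (y n - z) \<le> norm (x n - z)}"
    and D: "\<forall>n. closed (D (Suc n)) \<and> convex (D (Suc n)) \<and>
            fixed_points C T \<subseteq> D (Suc n) \<and> D (Suc n) \<subseteq> Cs (Suc n)"
    and x: "\<forall>n. x (Suc n) = metric_proj (D (Suc n)) x0"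
  have dec: "D (Suc n) \<subseteq> D n" for n
    using D[rule_format, of n] Cs by auto
  define Q where
    "Q = rec_nat C (\<lambda>n A. {z \<in> D (Suc n) \<inter> A. (z - x (Suc n)) \<bullet> (x (Suc n) - x0) \<ge> 0})"
  have Q: "Q 0 = C"
    "Q (Suc n) = {z \<in> D (Suc n) \<inter> Q n. (z - x (Suc n)) \<bullet> (x (Suc n) - x0) \<ge> 0}" for n
    by (simp_all add: Q_def)
  have "D (Suc n) \<subseteq> Q n" for n
    by (rule decreasing_subset_cut_sets
          [where D = "\<lambda>n. D (Suc n)" and Q = Q and B = "\<lambda>n. D (Suc n) \<inter> Q n"
            and x = x and a = x0])
      (use D0 Q D x dec dec[of 0] in auto)
  then have eq: "D (Suc n) \<inter> Q n = D (Suc n)" for n by blast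
  show "x \<longlonglongrightarrow> metric_proj (fixed_points C T) x0"
  proof (rule MCQ[unfolded MCQ_statement_def, rule_format, OF data])
    show "Cs (Suc 0) = {z \<in> C. norm (y 0 - z) \<le> norm (x 0 - z)}"
      using Cs D0 by simp
    show "Cs (Suc (Suc n)) =
        {z \<in> D (Suc n) \<inter> Q n. norm (y (Suc n) - z) \<le> norm (x (Suc n) - z)}" for n
      using Cs eq by simp
    show "Q 0 = C" by (rule Q)
    show "Q (Suc n) =
        {z \<in> D (Suc n) \<inter> Q n. (z - x (Suc n)) \<bullet> (x (Suc n) - x0) \<ge> 0}" for n
      by (rule Q)
    show "closed (D (Suc n)) \<and> convex (D (Suc n)) \<and> fixed_points C T \<subseteq> D (Suc n) \<and>
        D (Suc n) \<subseteq> Cs (Suc n)" for n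
      using D by blast
    show "x (Suc n) = metric_proj (D (Suc n) \<inter> Q n) x0" for n
      using x eq by simp
  qed
qed

theorem proposition8p7:
  shows "(CQ_statement TYPE('a::{real_inner, complete_space}) \<longrightarrow> MQ_statement TYPE('a)) \<and>
         (MQ_statement TYPE('a) \<longrightarrow> MC_statement TYPE('a)) \<and>
         (MC_statement TYPE('a) \<longleftrightarrow> MCQ_statement TYPE('a))"
  using CQ_imp_MQ MQ_imp_MC MC_imp_MCQ MCQ_imp_MC by blast

end
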